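(* Let $\mathsf R,\mathsf E$ be totally ordered finite sets with $|\mathsf R|=d\le n=|\mathsf E|$, let $(M_\sigma)$ be a polyhedral matching field extracted from a triangulation of $\triangle_{d-1}\times\triangle_{n-1}$, let $A\in\{+,-,0\}^{\mathsf R\times\mathsf E}$ be a sign matrix whose entries are non-zero at every edge appearing in some $M_\sigma$, and let $\chi$ be the chirotope $\sigma\mapsto\operatorname{sign}(M_\sigma)\prod_{e\in M_\sigma}A_e$. For any $(d+1)$-subset $\tau\subseteq\mathsf E$, there exist precisely two sign assignments $\tau\to\{+,-\}$ such that two adjacent nodes of the signed tree $\widetilde T_\tau$ are of the same sign if and only if the edge between them is positive. These are the two signed circuits supported on $\tau$ of the oriented matroid given by $\chi$.
   Context: **Polyhedral matching field.** A triangulation of $\triangle_{d-1}\times\triangle_{n-1}$ (with $\triangle_{k-1}=\operatorname{conv}\{\mathbf e_1,\dots,\mathbf e_k\}$) is a collection of full-dimensional simplices with vertices among the $(\mathbf e_i,\mathbf e_j)$, with union $\triangle_{d-1}\times\triangle_{n-1}$, any two intersecting in a common face. Identifying $(\mathbf e_i,\mathbf e_j)$ with the edge $(i,j)$ of $K_{\mathsf R,\mathsf E}$, each simplex becomes a spanning tree of $K_{\mathsf R,\mathsf E}$. For every $d$-subset $\sigma\subseteq\mathsf E$ there is exactly one perfect matching $M_\sigma$ between $\mathsf R$ and $\sigma$ contained in at least one of these trees; $(M_\sigma)$ is the polyhedral matching field. $\operatorname{sign}(M_\sigma)$ is the sign of the permutation $[d]\to\mathsf R\to\sigma\to[d]$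 (order-preserving bijections at both ends, $M_\sigma$ in the middle). The map $\chi$, extended to an alternating map $\mathsf E^d\to\{+,-,0\}$, is known to be the chirotope of a uniform oriented matroid of rank $d$. **The signed tree $\widetilde T_\tau$.** For a $(d+1)$-subset $\tau$, the union $T_\tau:=\bigcup_{\sigma\subset\tau}M_\sigma$ over all $d$-subsets $\sigma$ of $\tau$ is known to be a spanning tree of $K_{\mathsf R,\tau}$ in which every node of $\mathsf R$ has degree $2$. $\widetilde T_\tau$ is the tree with node set $\tau$ in which $u,v$ are joined by an edge if both are adjacent to the same $r\in\mathsf R$ in $T_\tau$. The edge $(u,v)$ of $\widetilde T_\tau$ coming from the edges $(u,r),(v,r)$ of $T_\tau$ is labelled by the sign $-A_{r,u}A_{r,v}$. Signed circuits are those of the oriented matroid defined by $\chi$ in the standard sense; for a uniform oriented matroid of rank $d$ every $(d+1)$-subset supports exactly two signed circuits, which are negatives of each other. *)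

theory Defs
  imports "HOL-Analysis.Analysis" "HOL-Combinatorics.Permutations"
begin

text \<open>
  The totally ordered finite sets R and E are the index types \<open>'r\<close> and \<open>'e\<close>, so that
  d is \<open>CARD('r)\<close>, n is \<open>CARD('e)\<close>, and the product of the two standard simplices lies in
  \<open>(real ^ 'r) \<times> (real ^ 'e)\<close>. Signs are the integers 1, -1 and 0.
\<close>

section \<open>Polyhedral matching fields\<close>

definition std_simplex :: "(real ^ 'k::finite) set" where
  "std_simplex = convex hull (range (\<lambda>i. axis i 1))"

definition product_vertex :: "'r::finite \<Rightarrow> 'e::finite \<Rightarrow> (real ^ 'r) \<times> (real ^ 'e)" where
  "product_vertex r e = (axis r 1, axis e 1)"

definition simplex_product_triangulation ::
    "((real ^ 'r::finite) \<times> (real ^ 'e::finite)) set set \<Rightarrow> bool" where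
  "simplex_product_triangulation \<T> \<longleftrightarrow>
     triangulation \<T> \<and>
     \<Union>\<T> = std_simplex \<times> std_simplex \<and>
     (\<forall>T\<in>\<T>. aff_dim T = aff_dim ((std_simplex :: (real ^ 'r) set) \<times> (std_simplex :: (real ^ 'e) set)) \<and>
            {v. v extreme_point_of T} \<subseteq> {product_vertex r e | r e. True})"

definition simplex_graph ::
    "((real ^ 'r::finite) \<times> (real ^ 'e::finite)) set \<Rightarrow> ('r \<times> 'e) set" where
  "simplex_graph T = {(r, e). product_vertex r e extreme_point_of T}"

definition perfect_matching :: "'e set \<Rightarrow> ('r \<times> 'e) set \<Rightarrow> bool" where
  "perfect_matching \<sigma> N \<longleftrightarrow>
     N \<subseteq> UNIV \<times> \<sigma> \<and> (\<forall>r. \<exists>!e. (r, e) \<in> N) \<and> (\<forall>e\<in>\<sigma>. \<exists>!r. (r, e) \<in> N)"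

text \<open>
  Uniqueness of the matching for each \<open>\<sigma>\<close> is a consequence of \<open>\<T>\<close> being a triangulation and
  is not imposed. The values of \<open>M\<close> outside the d-subsets are irrelevant.
\<close>

definition polyhedral_matching_field ::
    "((real ^ 'r::finite) \<times> (real ^ 'e::finite)) set set \<Rightarrow> ('e set \<Rightarrow> ('r \<times> 'e) set) \<Rightarrow> bool" where
  "polyhedral_matching_field \<T> M \<longleftrightarrow>
     (\<forall>\<sigma>. card \<sigma> = CARD('r) \<longrightarrow>
        perfect_matching \<sigma> (M \<sigma>) \<and> (\<exists>T\<in>\<T>. M \<sigma> \<subseteq> simplex_graph T))"

section \<open>The chirotope\<close>

text \<open>
  For a list \<open>xs\<close> of distinct elements, \<open>rank_perm xs\<close> is the permutation of \<open>{..<length xs}\<close>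
  taking a position to the (0-based) rank of its entry within \<open>set xs\<close>.
\<close>

definition rank_perm :: "'e::linorder list \<Rightarrow> nat \<Rightarrow> nat" where
  "rank_perm xs i = (if i < length xs then card {y \<in> set xs. y < xs ! i} else i)"

text \<open>
  Listing the partners of the elements of R in increasing order of R gives the composition of
  [d] \<open>\<rightarrow>\<close> R with the matching; \<open>rank_perm\<close> then applies \<open>\<sigma> \<rightarrow>\<close> [d].
\<close>

definition matching_sign :: "('r::{finite,linorder} \<times> 'e::linorder) set \<Rightarrow> int" where
  "matching_sign N =
     sign (rank_perm (map (\<lambda>r. THE e. (r, e) \<in> N) (sorted_list_of_set UNIV)))"

definition chi_set ::
    "('r::{finite,linorder} \<Rightarrow> 'e::linorder \<Rightarrow> int) \<Rightarrow> ('e set \<Rightarrow> ('r \<times> 'e) set) \<Rightarrow> 'e set \<Rightarrow> int" where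
  "chi_set A M \<sigma> = matching_sign (M \<sigma>) * (\<Prod>(r, e)\<in>M \<sigma>. A r e)"

text \<open>The alternating extension to d-tuples, encoded as lists of length d.\<close>

definition chi ::
    "('r::{finite,linorder} \<Rightarrow> 'e::linorder \<Rightarrow> int) \<Rightarrow> ('e set \<Rightarrow> ('r \<times> 'e) set) \<Rightarrow> 'e list \<Rightarrow> int" where
  "chi A M xs =
     (if length xs = CARD('r) \<and> distinct xs then sign (rank_perm xs) * chi_set A M (set xs) else 0)"

section \<open>Signed circuits of the oriented matroid given by a chirotope \<open>\<phi>\<close> of rank d\<close>

definition is_basis :: "nat \<Rightarrow> ('e list \<Rightarrow> int) \<Rightarrow> 'e set \<Rightarrow> bool" where
  "is_basis d \<phi> B \<longleftrightarrow> (\<exists>xs. length xs = d \<and> set xs = B \<and> \<phi> xs \<noteq> 0)"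

definition is_independent :: "nat \<Rightarrow> ('e list \<Rightarrow> int) \<Rightarrow> 'e set \<Rightarrow> bool" where
  "is_independent d \<phi> I \<longleftrightarrow> (\<exists>B. is_basis d \<phi> B \<and> I \<subseteq> B)"

definition is_circuit :: "nat \<Rightarrow> ('e list \<Rightarrow> int) \<Rightarrow> 'e set \<Rightarrow> bool" where
  "is_circuit d \<phi> S \<longleftrightarrow> \<not> is_independent d \<phi> S \<and> (\<forall>I. I \<subset> S \<longrightarrow> is_independent d \<phi> I)"

definition signed_support :: "('e \<Rightarrow> int) \<Rightarrow> 'e set" where
  "signed_support C = {e. C e \<noteq> 0}"

text \<open>
  A signed subset is a function to \<open>{-1, 0, 1}\<close>. The signed circuits are the signings of the
  circuits of the underlying matroid that satisfy the pivoting rule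
  \<open>\<phi>(f, x\<^sub>2, \<dots>, x\<^sub>d) = - C(e) C(f) \<phi>(e, x\<^sub>2, \<dots>, x\<^sub>d)\<close>
  of a basis orientation, whenever both tuples are ordered bases and C is supported on
  \<open>{e, f, x\<^sub>2, \<dots>, x\<^sub>d}\<close>.
\<close>

definition signed_circuits :: "nat \<Rightarrow> ('e list \<Rightarrow> int) \<Rightarrow> ('e \<Rightarrow> int) set" where
  "signed_circuits d \<phi> =
     {C. range C \<subseteq> {-1, 0, 1} \<and>
         is_circuit d \<phi> (signed_support C) \<and>
         (\<forall>e f xs. e \<noteq> f \<and> Suc (length xs) = d \<and> \<phi> (e # xs) \<noteq> 0 \<and> \<phi> (f # xs) \<noteq> 0 \<and>
                   signed_support C \<subseteq> {e, f} \<union> set xs \<longrightarrow>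
            \<phi> (f # xs) = - C e * C f * \<phi> (e # xs))}"

section \<open>The signed tree of a (d+1)-subset\<close>

definition linkage_tree ::
    "('e set \<Rightarrow> ('r::finite \<times> 'e) set) \<Rightarrow> 'e set \<Rightarrow> ('r \<times> 'e) set" where
  "linkage_tree M \<tau> = \<Union> (M ` {\<sigma>. \<sigma> \<subseteq> \<tau> \<and> card \<sigma> = CARD('r)})"

text \<open>The tree on the node set \<open>\<tau>\<close>, as the set of its edges paired with their labels.\<close>

definition signed_tree ::
    "('r::finite \<Rightarrow> 'e \<Rightarrow> int) \<Rightarrow> ('e set \<Rightarrow> ('r \<times> 'e) set) \<Rightarrow> 'e set \<Rightarrow> ('e set \<times> int) set" where
  "signed_tree A M \<tau> =
     {({u, v}, - A r u * A r v) | r u v.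
        u \<noteq> v \<and> (r, u) \<in> linkage_tree M \<tau> \<and> (r, v) \<in> linkage_tree M \<tau>}"

text \<open>
  Sign assignments on \<open>\<tau>\<close> are extended by 0 outside \<open>\<tau>\<close>, making them signed subsets.
\<close>

definition sign_assignments :: "'e set \<Rightarrow> ('e \<Rightarrow> int) set" where
  "sign_assignments \<tau> = {C. (\<forall>u\<in>\<tau>. C u \<in> {-1, 1}) \<and> (\<forall>u. u \<notin> \<tau> \<longrightarrow> C u = 0)}"

definition compatible_assignments :: "('e set \<times> int) set \<Rightarrow> 'e set \<Rightarrow> ('e \<Rightarrow> int) set" where
  "compatible_assignments G \<tau> =
     {C \<in> sign_assignments \<tau>. \<forall>u v s. ({u, v}, s) \<in> G \<longrightarrow> (C u = C v \<longleftrightarrow> s = 1)}"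

end

theory Submission
  imports Defs
begin

text \<open>
  Put \<open>\<Phi>(u) = (-1)\<^sup>k \<chi>(\<tau> - u)\<close>, where \<open>k\<close> is the number of elements of \<open>\<tau>\<close> below \<open>u\<close>. Since
  \<open>\<chi>\<close> is alternating, the pivoting rule says that the signed circuits on \<open>\<tau>\<close> are \<open>\<Phi>\<close> and \<open>-\<Phi>\<close>.

  Two sets of vertices of cells of a triangulation whose convex hulls have a common relative
  interior point coincide; applied to barycenters of matchings, this makes the matching on each
  \<open>\<sigma>\<close> unique. The cell containing a point with equal weights on R and equal weights on \<open>\<tau>\<close>
  satisfies Hall's condition for every \<open>\<tau> - u\<close>, hence contains all the matchings of \<open>T\<^sub>\<tau>\<close>.
  Counting edges, every R-node of \<open>T\<^sub>\<tau>\<close> has degree 2, and by uniqueness the matchings on \<open>\<tau> - u\<close>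
  and \<open>\<tau> - v\<close>, for \<open>u\<close> and \<open>v\<close> adjacent through \<open>r\<close>, differ in the partner of \<open>r\<close> only. Therefore
  \<open>\<Phi>(u) \<Phi>(v)\<close> is the label of the edge \<open>uv\<close>, and connectedness of the tree determines a compatible
  assignment up to a global sign.
\<close>

section \<open>Signs of rank permutations\<close>

definition lift_perm :: "(nat \<Rightarrow> nat) \<Rightarrow> nat \<Rightarrow> nat" where
  "lift_perm p i = (case i of 0 \<Rightarrow> 0 | Suc j \<Rightarrow> Suc (p j))"

lemma lift_perm_id: "lift_perm id = id"
  by (auto simp: lift_perm_def fun_eq_iff split: nat.split)

lemma lift_perm_transpose_comp:
  "lift_perm (Transposition.transpose a b \<circ> p) = Transposition.transpose (Suc a) (Suc b) \<circ> lift_perm p"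
  by (auto simp: lift_perm_def fun_eq_iff Transposition.transpose_def split: nat.split)

lemma permutation_transpose_comp:
  "permutation p \<Longrightarrow> permutation (Transposition.transpose a b \<circ> p)"
  by (intro permutation_compose permutation_swap_id)

lemma sign_transpose_comp:
  "a \<noteq> b \<Longrightarrow> permutation p \<Longrightarrow> sign (Transposition.transpose a b \<circ> p) = - sign p"
  by (simp add: sign_compose permutation_swap_id sign_swap_id)

text \<open>Lifting turns a transposition into a transposition of the shifted positions, so along a
  product of transpositions both signs flip together.\<close>

lemma lift_perm_permutation_sign:
  assumes "p permutes {..<n}"
  shows "permutation (lift_perm p) \<and> sign (lift_perm p) = sign p"
  using assms finite_lessThan
proof (induction rule: permutes_induct)
  case id
  then show ?case by (simp only: lift_perm_id sign_id permutation_id)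
next
  case (swap a b p)
  then have "permutation p"
    by (intro permutes_imp_permutation[OF finite_lessThan])
  with swap show ?case
    unfolding lift_perm_transpose_comp
    by (metis permutation_transpose_comp sign_transpose_comp nat.inject)
qed

text \<open>\<open>rank_perm (x # xs)\<close> is \<open>insertion_cycle k \<circ> lift_perm (rank_perm xs)\<close>, with \<open>k\<close> the rank of \<open>x\<close>.\<close>
definition insertion_cycle :: "nat \<Rightarrow> nat \<Rightarrow> nat" where
  "insertion_cycle k i = (if i = 0 then k else if i \<le> k then i - 1 else i)"

text \<open>A cycle on the positions \<open>0\<close> to \<open>k\<close>: each increase of
  \<open>k\<close> composes it with one more adjacent transposition.\<close>

lemma insertion_cycle_permutation_sign:
  "permutation (insertion_cycle k) \<and> sign (insertion_cycle k) = (-1) ^ k"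
proof (induction k)
  case 0
  have "insertion_cycle 0 = id"
    by (auto simp: insertion_cycle_def fun_eq_iff)
  then show ?case by (simp only: sign_id permutation_id power_0)
next
  case (Suc k)
  have "insertion_cycle (Suc k) = Transposition.transpose k (Suc k) \<circ> insertion_cycle k"
    by (auto simp: insertion_cycle_def fun_eq_iff Transposition.transpose_def)
  moreover have "(-1) ^ Suc k = - ((-1) ^ k :: int)" by simp
  ultimately show ?case
    using Suc by (metis permutation_transpose_comp sign_transpose_comp n_not_Suc_n)
qed

section \<open>Ranks of list entries, and the sign under moving an entry\<close>

lemma card_less_strict_mono:
  fixes a b :: "'a::linorder"
  assumes "finite S" "a \<in> S" "a < b"
  shows "card {y \<in> S. y < a} < card {y \<in> S. y < b}"
  using assms by (intro psubset_card_mono) auto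

lemma card_less_le_iff:
  fixes a b :: "'a::linorder"
  assumes "finite S" "a \<in> S" 
  shows "card {y \<in> S. y < b} \<le> card {y \<in> S. y < a} \<longleftrightarrow> b \<le> a"
proof (cases "b \<le> a")
  case True
  with assms show ?thesis by (auto intro!: card_mono)
next
  case False
  with card_less_strict_mono[OF assms, of b] show ?thesis by (simp add: not_le)
qed

lemma rank_perm_permutes:
  assumes "distinct xs"
  shows "rank_perm xs permutes {..<length xs}"
proof (rule bij_imp_permutes)
  have lt: "rank_perm xs i < length xs" if "i < length xs" for i
  proof -
    have "card {y \<in> set xs. y < xs ! i} < card (set xs)"
      using that by (intro psubset_card_mono) (auto intro!: psubsetI nth_mem)
    also have "\<dots> \<le> length xs" by (rule card_length)
    finally show ?thesis using that by (simp add: rank_perm_def)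
  qed
  have "inj_on (rank_perm xs) {..<length xs}"
  proof (rule inj_onI)
    fix i j assume ij: "i \<in> {..<length xs}" "j \<in> {..<length xs}" "rank_perm xs i = rank_perm xs j"
    then have eq: "card {y \<in> set xs. y < xs ! i} = card {y \<in> set xs. y < xs ! j}"
      by (simp add: rank_perm_def)
    from ij have "xs ! i \<in> set xs" "xs ! j \<in> set xs" by auto
    from this[THEN card_less_le_iff[OF finite_set]] have "xs ! i = xs ! j"
      by (metis eq antisym order_refl)
    with ij assms show "i = j" by (simp add: nth_eq_iff_index_eq)
  qed
  with lt show "bij_betw (rank_perm xs) {..<length xs} {..<length xs}"
    unfolding bij_betw_def by (intro conjI endo_inj_surj) auto
qed (auto simp: rank_perm_def)

text \<open>Laplace expansion along the head: the exponent counts the inversions in which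
  \<open>x\<close> takes part.\<close>

lemma sign_rank_perm_Cons:
  assumes "distinct (x # xs)"
  shows "sign (rank_perm (x # xs)) = (-1) ^ card {y \<in> set xs. y < x} * sign (rank_perm xs)"
proof -
  let ?k = "card {y \<in> set xs. y < x}"
  \<comment> \<open>Inserting \<open>x\<close> raises by one the rank of exactly the entries above
    \<open>x\<close>.\<close>
  have *: "card {y \<in> set (x # xs). y < xs ! j} = 
      (if x < xs ! j then Suc (card {y \<in> set xs. y < xs ! j}) else card {y \<in> set xs. y < xs ! j})" for j
  proof (cases "x < xs ! j")
    case True
    then have "{y \<in> set (x # xs). y < xs ! j} = insert x {y \<in> set xs. y < xs ! j}" by auto
    with True assms show ?thesis by simp
  next
    case False
    then have "{y \<in> set (x # xs). y < xs ! j} = {y \<in> set xs. y < xs ! j}" by auto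
    with False show ?thesis by simp
  qed
  have "rank_perm (x # xs) i = insertion_cycle ?k (lift_perm (rank_perm xs) i)" for i
  proof (cases i)
    case 0
    have "{y \<in> set (x # xs). y < x} = {y \<in> set xs. y < x}" by auto
    with 0 show ?thesis by (simp add: rank_perm_def insertion_cycle_def lift_perm_def)
  next
    case (Suc j)
    show ?thesis
    proof (cases "j < length xs")
      case True
      then have "xs ! j \<in> set xs" by simp
      with assms card_less_le_iff[OF finite_set this, of x] show ?thesis
        unfolding Suc lift_perm_def insertion_cycle_def
        using True * by (auto simp: rank_perm_def not_le simp del: list.set)
    next
      case False
      \<comment> \<open>Hence \<open>Suc j > ?k\<close> for every position beyond the list, and the
        cycle fixes it.\<close>
      have "?k \<le> length xs"
        by (rule order_trans[OF card_mono card_length]) auto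
      with False Suc show ?thesis
        by (auto simp: rank_perm_def lift_perm_def insertion_cycle_def)
    qed
  qed
  then have "rank_perm (x # xs) = insertion_cycle ?k \<circ> lift_perm (rank_perm xs)"
    by (simp add: fun_eq_iff)
  then show ?thesis
    using assms lift_perm_permutation_sign[OF rank_perm_permutes, of xs]
    by (simp add: sign_compose insertion_cycle_permutation_sign)
qed

text \<open>Expanding both lists twice leaves the same tail. The exponents differ only by the
  comparison of \<open>x\<close> with \<open>y\<close>, which contributes to exactly one
  side.\<close>

lemma sign_rank_perm_swap:
  assumes "distinct (x # y # xs)"
  shows "sign (rank_perm (y # x # xs)) = - sign (rank_perm (x # y # xs))"
proof -
  have *: "card {z \<in> set (a # xs). z < b} = card {z \<in> set xs. z < b} + (if a < b then 1 else 0)"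
    if "a \<notin> set xs" for a b
  proof (cases "a < b")
    case True
    then have "{z \<in> set (a # xs). z < b} = insert a {z \<in> set xs. z < b}" by auto
    with True that show ?thesis by simp
  next
    case False
    then have "{z \<in> set (a # xs). z < b} = {z \<in> set xs. z < b}" by auto
    with False show ?thesis by simp
  qed
  have "sign (rank_perm (y # x # xs)) =
      (-1) ^ card {z \<in> set (x # xs). z < y} * ((-1) ^ card {z \<in> set xs. z < x} * sign (rank_perm xs))"
    using assms sign_rank_perm_Cons[of y "x # xs"] sign_rank_perm_Cons[of x xs] by auto
  moreover have "sign (rank_perm (x # y # xs)) =
      (-1) ^ card {z \<in> set (y # xs). z < x} * ((-1) ^ card {z \<in> set xs. z < y} * sign (rank_perm xs))"
    using assms sign_rank_perm_Cons[of x "y # xs"] sign_rank_perm_Cons[of y xs] by auto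
  moreover have "x < y \<or> y < x" "x \<notin> set xs" "y \<notin> set xs" using assms by auto
  ultimately show ?thesis
    by (auto simp: * power_add simp del: list.set)
qed

text \<open>\<open>x\<close> moves to the front by one adjacent swap per element of
  \<open>as\<close>; expanding along the head \<open>a\<close> is unaffected by the order of the
  rest.\<close>

lemma sign_rank_perm_append_Cons:
  assumes "distinct (as @ x # bs)"
  shows "sign (rank_perm (as @ x # bs)) = (-1) ^ length as * sign (rank_perm (x # as @ bs))"
  using assms
proof (induction as)
  case (Cons a as)
  have "sign (rank_perm ((a # as) @ x # bs)) =
      (-1) ^ card {y \<in> set (as @ x # bs). y < a} * sign (rank_perm (as @ x # bs))"
    using Cons.prems by (simp add: sign_rank_perm_Cons)
  also have "\<dots> = (-1) ^ length as * ((-1) ^ card {y \<in> set (x # as @ bs). y < a} * sign (rank_perm (x # as @ bs)))"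
    using Cons by (simp add: insert_commute)
  also have "\<dots> = (-1) ^ length as * sign (rank_perm (a # x # as @ bs))"
    using Cons.prems by (subst (2) sign_rank_perm_Cons) auto
  also have "\<dots> = (-1) ^ length (a # as) * sign (rank_perm (x # (a # as) @ bs))"
    using Cons.prems sign_rank_perm_swap[of a x "as @ bs"] by simp
  finally show ?case .
qed simp

section \<open>Hall's theorem and matchings in a triangulation\<close>

text \<open>Rado's argument: elements are dropped from the sets \<open>N r\<close>, preserving
  Hall's condition, until all are singletons, which the condition for pairs then makes distinct. The
  induction is on the total size.\<close>

lemma hall_marriage:
  fixes N :: "'a \<Rightarrow> 'b set"
  assumes "finite R" "\<And>r. r \<in> R \<Longrightarrow> finite (N r)"
    and "\<And>S. S \<subseteq> R \<Longrightarrow> card S \<le> card (\<Union> (N ` S))"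
  shows "\<exists>f. inj_on f R \<and> (\<forall>r\<in>R. f r \<in> N r)"
  using assms(2,3)
proof (induction "\<Sum>r\<in>R. card (N r)" arbitrary: N rule: less_induct)
  case less
  have fin: "finite (\<Union> (N ` S))" if "S \<subseteq> R" for S
    using that less.prems(1) finite_subset[OF that assms(1)] by auto
  show ?case
  proof (cases "\<exists>r\<in>R. \<exists>x\<in>N r. \<exists>y\<in>N r. x \<noteq> y")
    case False
    have "\<exists>x. N r = {x}" if "r \<in> R" for r
    proof -
      have "1 \<le> card (N r)" using less.prems(2)[of "{r}"] that by simp
      then have "N r \<noteq> {}" by auto
      with False that show ?thesis by blast
    qed
    then obtain f where f: "\<And>r. r \<in> R \<Longrightarrow> N r = {f r}" by metis
    have "inj_on f R"
    proof (rule inj_onI)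
      fix r s assume rs: "r \<in> R" "s \<in> R" "f r = f s"
      have "card {r, s} \<le> card (\<Union> (N ` {r, s}))" using rs by (intro less.prems(2)) auto
      with rs f show "r = s" by (cases "r = s") auto
    qed
    with f show ?thesis by auto
  next
    case True
    then obtain r x y where rxy: "r \<in> R" "x \<in> N r" "y \<in> N r" "x \<noteq> y" by blast
    \<comment> \<open>Dropping \<open>z\<close> from \<open>N r\<close> affects only sets of the
      form \<open>insert r S\<close>; the strict inequality for \<open>S\<close> is Hall's condition
      for these.\<close>
    have shrink: "\<exists>f. inj_on f R \<and> (\<forall>s\<in>R. f s \<in> N s)"
      if "z \<in> N r" "\<And>S. S \<subseteq> R - {r} \<Longrightarrow> card S < card (\<Union> (N ` S) \<union> (N r - {z}))" for z
    proof -
      let ?N = "N(r := N r - {z})"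
      have "\<exists>f. inj_on f R \<and> (\<forall>s\<in>R. f s \<in> ?N s)"
      proof (rule less.hyps)
        show "(\<Sum>s\<in>R. card (?N s)) < (\<Sum>s\<in>R. card (N s))"
          using assms(1) rxy(1) that(1) less.prems(1)
          by (intro sum_strict_mono_ex1)
            (auto intro!: card_mono card_Diff1_less bexI[of _ r] simp del: card_Diff_singleton card_Diff_insert)
        show "finite (?N s)" if "s \<in> R" for s using that less.prems(1) by auto
        fix S assume S: "S \<subseteq> R"
        show "card S \<le> card (\<Union> (?N ` S))"
        proof (cases "r \<in> S")
          case True
          have "\<Union> (?N ` S) = \<Union> (N ` (S - {r})) \<union> (N r - {z})"
            using True by (auto split: if_splits)
          moreover have "card (S - {r}) < card (\<Union> (N ` (S - {r})) \<union> (N r - {z}))"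
            using S by (intro that(2)) auto
          moreover have "card S = Suc (card (S - {r}))"
            using True S assms(1) by (metis card.remove finite_subset)
          ultimately show ?thesis by simp
        next
          case False
          then have "\<Union> (?N ` S) = \<Union> (N ` S)" by (auto split: if_splits)
          with less.prems(2)[OF S] show ?thesis by simp
        qed
      qed
      then show ?thesis by (fastforce split: if_splits)
    qed
    \<comment> \<open>Submodularity: if neither \<open>x\<close> nor \<open>y\<close> could be dropped from \<open>N r\<close>, the two
      violating sets would together violate the condition for \<open>N\<close>.\<close>
    show ?thesis
    proof (rule ccontr)
      assume no: "\<not> ?thesis"
      obtain S where S: "S \<subseteq> R - {r}" "card (\<Union> (N ` S) \<union> (N r - {x})) \<le> card S"
        using shrink[OF rxy(2)] no by (meson not_le)
      obtain T where T: "T \<subseteq> R - {r}" "card (\<Union> (N ` T) \<union> (N r - {y})) \<le> card T"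
        using shrink[OF rxy(3)] no by (meson not_le)
      let ?A = "\<Union> (N ` S) \<union> (N r - {x})" and ?B = "\<Union> (N ` T) \<union> (N r - {y})"
      have finS: "finite S" "finite T" using S(1) T(1) assms(1) by (auto intro: finite_subset)
      have finA: "finite ?A" "finite ?B"
        using fin[of S] fin[of T] S(1) T(1) less.prems(1)[OF rxy(1)] by auto
      have "card (insert r (S \<union> T)) \<le> card (\<Union> (N ` insert r (S \<union> T)))"
        using S(1) T(1) rxy(1) by (intro less.prems(2)) auto
      \<comment> \<open>As \<open>x\<close> and \<open>y\<close> differ, \<open>?A\<close> and
        \<open>?B\<close> together still cover all of \<open>N r\<close>.\<close>
      also have "\<dots> \<le> card (?A \<union> ?B)"
        using finA rxy by (intro card_mono) auto
      finally have 1: "Suc (card (S \<union> T)) \<le> card (?A \<union> ?B)"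
        using S(1) T(1) finS by (subst (asm) card_insert_disjoint) auto
      have "card (S \<inter> T) \<le> card (\<Union> (N ` (S \<inter> T)))"
        using S(1) by (intro less.prems(2)) auto
      also have "\<dots> \<le> card (?A \<inter> ?B)"
        using finA by (intro card_mono) auto
      finally have "card (S \<inter> T) \<le> card (?A \<inter> ?B)" .
      with 1 S(2) T(2) card_Un_Int[OF finS] card_Un_Int[OF finA] show False by linarith
    qed
  qed
qed

section \<open>Matchings as vertex sets of faces of cells\<close>

lemma product_vertex_inj: "product_vertex r e = product_vertex r' e' \<longleftrightarrow> r = r' \<and> e = e'"
  by (auto simp: product_vertex_def axis_eq_axis)

lemma inj_product_vertex: "inj_on (\<lambda>(r, e). product_vertex r e) S"
  by (auto simp: inj_on_def product_vertex_inj)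

lemma triangulation_simplex_vertices:
  assumes "triangulation \<T>" "T \<in> \<T>"
  shows "\<not> affine_dependent {v. v extreme_point_of T}" 
    and "T = convex hull {v. v extreme_point_of T}"
proof -
  from assms obtain n where "n simplex T" unfolding triangulation_def by blast
  then obtain C where C: "\<not> affine_dependent C" "T = convex hull C"
    unfolding simplex_def by blast
  then have "{v. v extreme_point_of T} = C"
    by (simp add: extreme_point_of_convex_hull_affine_independent)
  with C show "\<not> affine_dependent {v. v extreme_point_of T}" "T = convex hull {v. v extreme_point_of T}" 
    by auto
qed

text \<open>The common face \<open>T \<inter> T'\<close> contains \<open>p\<close>, hence the whole
  face \<open>convex hull X\<close>, which is therefore a face of \<open>T'\<close> as well. Faces
  of \<open>T'\<close> whose relative interiors meet are equal, and their extreme points recover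
  \<open>X\<close> and \<open>X'\<close>.\<close>

lemma triangulation_vertex_sets_eq:
  assumes tri: "triangulation \<T>" "T \<in> \<T>" "T' \<in> \<T>"
    and X: "X \<subseteq> {v. v extreme_point_of T}" and X': "X' \<subseteq> {v. v extreme_point_of T'}"
    and p: "p \<in> rel_interior (convex hull X)" "p \<in> rel_interior (convex hull X')"
  shows "X = X'"
proof -
  note T = triangulation_simplex_vertices[OF tri(1,2)]
  note T' = triangulation_simplex_vertices[OF tri(1,3)]
  have face: "convex hull X face_of T" "convex hull X' face_of T'"
    using face_of_convex_hull_affine_independent[OF T(1)] X T(2)
      face_of_convex_hull_affine_independent[OF T'(1)] X' T'(2) by auto
  have "(T \<inter> T') face_of T" "(T \<inter> T') face_of T'"
    using tri unfolding triangulation_def by (blast, metis Int_commute)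
  have "p \<in> T \<inter> T'"
    using p rel_interior_subset face face_of_imp_subset by blast
  then have "convex hull X \<subseteq> T \<inter> T'"
    using p(1) face_of_imp_subset[OF face(1)]
    by (intro subset_of_face_of[OF \<open>(T \<inter> T') face_of T\<close>]) auto
  then have "convex hull X face_of T'"
    using face_of_subset[OF face(1)] \<open>(T \<inter> T') face_of T'\<close> face_of_trans by blast
  with face(2) p have eq: "convex hull X = convex hull X'"
    by (intro face_of_eq) auto
  have "v \<in> X \<longleftrightarrow> v \<in> X'" for v
    using extreme_point_of_convex_hull_affine_independent[OF affine_independent_subset[OF T(1) X], of v]
      extreme_point_of_convex_hull_affine_independent[OF affine_independent_subset[OF T'(1) X'], of v] 
    by (simp add: eq)
  then show ?thesis by blast
qed

lemma perfect_matching_bij: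
  assumes "perfect_matching \<sigma> (N :: ('r::finite \<times> 'e) set)"
  shows "bij_betw fst N UNIV" "bij_betw snd N \<sigma>"
proof -
  have N: "N \<subseteq> UNIV \<times> \<sigma>" "\<And>r. \<exists>!e. (r, e) \<in> N" "\<And>e. e \<in> \<sigma> \<Longrightarrow> \<exists>!r. (r, e) \<in> N"
    using assms unfolding perfect_matching_def by blast+
  have "inj_on fst N" unfolding inj_on_def using N(2) by (metis prod.collapse)
  moreover have "fst ` N = UNIV" using N(2) by (force simp: image_iff)
  ultimately show "bij_betw fst N UNIV" by (simp add: bij_betw_def)
  have "inj_on snd N" unfolding inj_on_def using N(1,3) by (metis mem_Sigma_iff prod.collapse subsetD)
  moreover have "snd ` N = \<sigma>" using N(1,3) by (force simp: image_iff)
  ultimately show "bij_betw snd N \<sigma>" by (simp add: bij_betw_def)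
qed

text \<open>Equal weights on the edges give a point that depends on \<open>\<sigma>\<close> only, so
  all matchings on \<open>\<sigma>\<close> share it. It is a relative interior point because the
  weights are positive and the vertices affinely independent.\<close>

lemma perfect_matching_barycenter:
  fixes N :: "('r::finite \<times> 'e::finite) set"
  assumes N: "perfect_matching \<sigma> N"
    and indep: "\<not> affine_dependent ((\<lambda>(r, e). product_vertex r e) ` N)"
  defines "c \<equiv> 1 / real CARD('r)"
  shows "((\<Sum>r\<in>UNIV. c *\<^sub>R axis r 1), (\<Sum>e\<in>\<sigma>. c *\<^sub>R axis e 1)) 
    \<in> rel_interior (convex hull ((\<lambda>(r, e). product_vertex r e) ` N))"
proof -
  note bij = perfect_matching_bij[OF N]
  have "card N = CARD('r)" using bij_betw_same_card[OF bij(1)] by simp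
  then have 1: "(\<Sum>v\<in>(\<lambda>(r, e). product_vertex r e) ` N. c) = 1"
    by (simp add: card_image[OF inj_product_vertex] c_def)
  have "(\<Sum>v\<in>(\<lambda>(r, e). product_vertex r e) ` N. c *\<^sub>R v) = (\<Sum>x\<in>N. c *\<^sub>R product_vertex (fst x) (snd x))"
    by (subst sum.reindex[OF inj_product_vertex]) (simp add: case_prod_unfold)
  also have "\<dots> = ((\<Sum>x\<in>N. c *\<^sub>R axis (fst x) 1), (\<Sum>x\<in>N. c *\<^sub>R axis (snd x) 1))"
    by (simp add: product_vertex_def prod_eq_iff fst_sum snd_sum)
  also have "(\<Sum>x\<in>N. c *\<^sub>R axis (fst x) 1) = (\<Sum>r\<in>UNIV. c *\<^sub>R axis r 1 :: real^'r)"
    by (rule sum.reindex_bij_betw[OF bij(1)])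
  also have "(\<Sum>x\<in>N. c *\<^sub>R axis (snd x) 1) = (\<Sum>e\<in>\<sigma>. c *\<^sub>R axis e 1 :: real^'e)"
    by (rule sum.reindex_bij_betw[OF bij(2)])
  finally show ?thesis
    unfolding rel_interior_convex_hull_explicit[OF indep] using 1 
    by (intro CollectI exI[of _ "\<lambda>_. c"]) (auto simp: c_def)
qed

text \<open>The two hulls share the barycenter. The case \<open>T = T'\<close> is included and gives
  uniqueness within one cell.\<close>

lemma matching_in_triangulation_unique:
  fixes \<T> :: "((real ^ 'r::finite) \<times> (real ^ 'e::finite)) set set"
  assumes tri: "triangulation \<T>" "T \<in> \<T>" "T' \<in> \<T>"
    and N: "perfect_matching \<sigma> N" "N \<subseteq> simplex_graph T"
    and N': "perfect_matching \<sigma> N'" "N' \<subseteq> simplex_graph T'"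
  shows "N = N'"
proof -
  let ?pv = "\<lambda>(r :: 'r, e :: 'e). product_vertex r e"
  have sub: "?pv ` N \<subseteq> {v. v extreme_point_of T}" "?pv ` N' \<subseteq> {v. v extreme_point_of T'}"
    using N(2) N'(2) by (auto simp: simplex_graph_def)
  have "?pv ` N = ?pv ` N'"
    using triangulation_vertex_sets_eq[OF tri sub]
      perfect_matching_barycenter[OF N(1) affine_independent_subset[OF triangulation_simplex_vertices(1)[OF tri(1,2)] sub(1)]]
      perfect_matching_barycenter[OF N'(1) affine_independent_subset[OF triangulation_simplex_vertices(1)[OF tri(1,3)] sub(2)]]
    by blast
  then show ?thesis by (simp add: inj_on_image_eq_iff[OF inj_product_vertex[of UNIV]])
qed

text \<open>
  The simplex is the one containing the point with coordinates \<open>1/d\<close> on R and \<open>1/(d+1)\<close> on \<open>\<tau>\<close>.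
  The strict inequality is Hall's condition with one element of \<open>\<tau>\<close> to spare.
\<close>
lemma triangulation_graph_cell:
  fixes \<T> :: "((real ^ 'r::finite) \<times> (real ^ 'e::finite)) set set"
  assumes tri: "simplex_product_triangulation \<T>"
    and \<tau>: "card (\<tau> :: 'e set) = CARD('r) + 1"
  obtains T where "T \<in> \<T>"
    "\<And>S. S \<noteq> {} \<Longrightarrow> card S < card {e \<in> \<tau>. \<exists>r\<in>S. (r, e) \<in> simplex_graph T}"
proof -
  let ?d = "real CARD('r)"
  let ?pv = "\<lambda>(r :: 'r, e :: 'e). product_vertex r e"
  define a :: "real ^ 'r" where "a = (\<chi> r. 1 / ?d)"
  define b :: "real ^ 'e" where "b = (\<chi> e. if e \<in> \<tau> then 1 / (?d + 1) else 0)"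
  have in_simplex: "x \<in> std_simplex" if "\<And>i. 0 \<le> x $ i" "(\<Sum>i\<in>UNIV. x $ i) = 1" for x :: "real ^ 'k::finite"
  proof -
    have "(\<Sum>i\<in>UNIV. x $ i *\<^sub>R axis i 1) \<in> convex hull (range (\<lambda>i. axis i 1 :: real ^ 'k))"
      using that by (intro convex_sum) (auto intro: hull_inc)
    also have "(\<Sum>i\<in>UNIV. x $ i *\<^sub>R axis i 1) = x"
      using basis_expansion[of x] by (simp add: scalar_mult_eq_scaleR)
    finally show ?thesis by (simp add: std_simplex_def)
  qed
  have "a \<in> std_simplex" by (intro in_simplex) (auto simp: a_def)
  moreover have "b \<in> std_simplex"
    using \<tau> by (intro in_simplex) (auto simp: b_def sum.If_cases)
  ultimately have "(a, b) \<in> \<Union>\<T>"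
    using tri unfolding simplex_product_triangulation_def by simp
  then obtain T where T: "T \<in> \<T>" "(a, b) \<in> T" by blast
  have tri': "triangulation \<T>" using tri unfolding simplex_product_triangulation_def by blast
  let ?V = "{v. v extreme_point_of T}"
  note V = triangulation_simplex_vertices[OF tri' T(1)]
  have finV: "finite ?V" using V(1) by (rule aff_independent_finite)
  have V_eq: "?V = ?pv ` simplex_graph T"
    using tri T(1) unfolding simplex_product_triangulation_def simplex_graph_def by (fastforce simp: image_iff)
  from T(2) V(2) have "(a, b) \<in> convex hull ?V" by simp
  then obtain u where u: "\<And>v. v \<in> ?V \<Longrightarrow> 0 \<le> u v" "(\<Sum>v\<in>?V. u v *\<^sub>R v) = (a, b)"
    unfolding convex_hull_finite[OF finV] by blast
  \<comment> \<open>The convex coefficients of \<open>(a, b)\<close>, read as a matrix with zeros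
    off the graph: its row sums are \<open>1 / d\<close>, its column sums \<open>1 / (d + 1)\<close>
    on \<open>\<tau>\<close> and 0 elsewhere.\<close>
  define w where "w r e = (if (r, e) \<in> simplex_graph T then u (product_vertex r e) else 0)" for r e
  have w_nonneg: "0 \<le> w r e" for r e
    using u(1) by (auto simp: w_def simplex_graph_def)
  have "(a, b) = (\<Sum>(r, e)\<in>simplex_graph T. w r e *\<^sub>R product_vertex r e)"
    unfolding u(2)[symmetric] V_eq
    by (subst sum.reindex[OF inj_product_vertex]) (auto simp: w_def intro!: sum.cong)
  also have "\<dots> = (\<Sum>(r, e)\<in>UNIV. w r e *\<^sub>R product_vertex r e)"
    by (rule sum.mono_neutral_left) (auto simp: w_def)
  finally have ab: "(a, b) = (\<Sum>(r, e)\<in>UNIV. w r e *\<^sub>R product_vertex r e)" .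
  have a_sum: "(\<Sum>e\<in>UNIV. w r e) = 1 / ?d" for r
  proof -
    have "1 / ?d = fst (a, b) $ r" by (simp add: a_def)
    also have "\<dots> = (\<Sum>(r', e)\<in>UNIV. w r' e * axis r' 1 $ r)"
      unfolding ab by (simp add: fst_sum case_prod_unfold product_vertex_def)
    also have "\<dots> = (\<Sum>r'\<in>UNIV. \<Sum>e\<in>UNIV. if r' = r then w r' e else 0)"
      unfolding UNIV_Times_UNIV[symmetric] sum.cartesian_product[symmetric]
      by (intro sum.cong) (auto simp: axis_def)
    also have "\<dots> = (\<Sum>e\<in>UNIV. w r e)"
      by (subst sum.swap) simp
    finally show ?thesis by simp
  qed
  have b_sum: "(\<Sum>r\<in>UNIV. w r e) = (if e \<in> \<tau> then 1 / (?d + 1) else 0)" for e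
  proof -
    have "(if e \<in> \<tau> then 1 / (?d + 1) else 0) = snd (a, b) $ e" by (simp add: b_def)
    also have "\<dots> = (\<Sum>(r, e')\<in>UNIV. w r e' * axis e' 1 $ e)"
      unfolding ab by (simp add: snd_sum case_prod_unfold product_vertex_def)
    also have "\<dots> = (\<Sum>r\<in>UNIV. \<Sum>e'\<in>UNIV. if e' = e then w r e' else 0)"
      unfolding UNIV_Times_UNIV[symmetric] sum.cartesian_product[symmetric]
      by (intro sum.cong) (auto simp: axis_def)
    also have "\<dots> = (\<Sum>r\<in>UNIV. w r e)" by simp
    finally show ?thesis by simp
  qed
  have w_zero: "w r e = 0" if "e \<notin> \<tau>" for r e
    using b_sum[of e] that w_nonneg by (simp add: sum_nonneg_eq_0_iff)
  show thesis
  proof (rule that[OF T(1)])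
    fix S :: "'r set"
    assume "S \<noteq> {}"
    define N where "N = {e \<in> \<tau>. \<exists>r\<in>S. (r, e) \<in> simplex_graph T}"
    \<comment> \<open>All weight in the rows of \<open>S\<close> sits in the columns of
      \<open>N\<close>, whose total weight is \<open>card N / (d + 1)\<close>.\<close>
    have "real (card S) / ?d = (\<Sum>r\<in>S. \<Sum>e\<in>UNIV. w r e)" by (simp add: a_sum)
    also have "\<dots> = (\<Sum>r\<in>S. \<Sum>e\<in>N. w r e)"
    proof (intro sum.cong[OF refl] sum.mono_neutral_right)
      show "\<forall>e\<in>UNIV - N. w r e = 0" if "r \<in> S" for r
      proof
        fix e assume "e \<in> UNIV - N"
        then show "w r e = 0"
          using that w_zero[of e r] by (cases "e \<in> \<tau>") (auto simp: N_def w_def)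
      qed
    qed auto
    also have "\<dots> \<le> (\<Sum>r\<in>UNIV. \<Sum>e\<in>N. w r e)"
      by (intro sum_mono2) (auto intro!: sum_nonneg w_nonneg)
    also have "\<dots> = (\<Sum>e\<in>N. 1 / (?d + 1))"
      by (subst sum.swap) (auto simp: b_sum N_def intro!: sum.cong)
    finally have "real (card S) / ?d \<le> real (card N) / (?d + 1)" by simp
    then have "real (card S) * (?d + 1) \<le> real (card N) * ?d"
      by (simp add: field_simps)
    \<comment> \<open>The surplus \<open>card S\<close> on the left makes the comparison
      strict.\<close>
    moreover have "0 < real (card S)" using \<open>S \<noteq> {}\<close> by (simp add: card_gt_0_iff)
    ultimately have "real (card S) * ?d < real (card N) * ?d" unfolding distrib_left by linarith
    then show "card S < card N" by simp
  qed
qed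

text \<open>One cell serves all \<open>\<sigma>\<close> at once: the strict inequality survives the
  loss of one element of \<open>\<tau>\<close>, so Hall's theorem finds a matching on
  \<open>\<sigma>\<close> inside this cell, and by uniqueness it is
  \<open>M \<sigma>\<close>.\<close>

lemma linkage_tree_subset_simplex_graph:
  fixes \<T> :: "((real ^ 'r::finite) \<times> (real ^ 'e::finite)) set set"
  assumes tri: "simplex_product_triangulation \<T>"
    and M: "polyhedral_matching_field \<T> M"
    and \<tau>: "card \<tau> = CARD('r) + 1"
  obtains T where "T \<in> \<T>" "linkage_tree M \<tau> \<subseteq> simplex_graph T"
proof -
  obtain T where T: "T \<in> \<T>"
    "\<And>S. S \<noteq> {} \<Longrightarrow> card S < card {e \<in> \<tau>. \<exists>r\<in>S. (r, e) \<in> simplex_graph T}"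
    using triangulation_graph_cell[OF tri \<tau>] by blast
  have tri': "triangulation \<T>" using tri unfolding simplex_product_triangulation_def by blast
  have "M \<sigma> \<subseteq> simplex_graph T" if \<sigma>: "\<sigma> \<subseteq> \<tau>" "card \<sigma> = CARD('r)" for \<sigma>
  proof -
    let ?N = "\<lambda>r. {e \<in> \<sigma>. (r, e) \<in> simplex_graph T}"
    have "\<exists>f. inj_on f (UNIV :: 'r set) \<and> (\<forall>r\<in>UNIV. f r \<in> ?N r)"
    proof (rule hall_marriage)
      fix S :: "'r set"
      show "card S \<le> card (\<Union> (?N ` S))"
      proof (cases "S = {}")
        case False
        let ?A = "{e \<in> \<tau>. \<exists>r\<in>S. (r, e) \<in> simplex_graph T}"
        have "?A \<subseteq> \<Union> (?N ` S) \<union> (\<tau> - \<sigma>)" by auto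
        then have "card ?A \<le> card (\<Union> (?N ` S) \<union> (\<tau> - \<sigma>))" by (intro card_mono) auto
        also have "\<dots> \<le> card (\<Union> (?N ` S)) + card (\<tau> - \<sigma>)" by (rule card_Un_le)
        also have "card (\<tau> - \<sigma>) = 1" using \<sigma> \<tau> by (simp add: card_Diff_subset)
        finally show ?thesis using T(2)[OF False] by simp
      qed simp
    qed auto
    then obtain f where f: "inj f" "\<And>r. f r \<in> \<sigma>" "\<And>r. (r, f r) \<in> simplex_graph T" by blast
    have "range f = \<sigma>"
      using f \<sigma>(2) by (intro card_subset_eq) (auto simp: card_image)
    with f(1) have "perfect_matching \<sigma> (range (\<lambda>r. (r, f r)))"
      unfolding perfect_matching_def by (auto simp: inj_def image_iff)
    moreover obtain T' where "T' \<in> \<T>" "M \<sigma> \<subseteq> simplex_graph T'" "perfect_matching \<sigma> (M \<sigma>)"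
      using M \<sigma>(2) unfolding polyhedral_matching_field_def by blast
    moreover have "range (\<lambda>r. (r, f r)) \<subseteq> simplex_graph T" using f(3) by auto
    ultimately have "M \<sigma> = range (\<lambda>r. (r, f r))"
      using matching_in_triangulation_unique[OF tri' _ T(1)] by blast
    with f(3) show ?thesis by auto
  qed
  then have "linkage_tree M \<tau> \<subseteq> simplex_graph T" unfolding linkage_tree_def by blast
  with T(1) show thesis by (rule that)
qed

text \<open>The geometric form of the edge bound for forests: the vertices over
  \<open>\<tau>\<close> lie in the affine hull of \<open>CARD('r) + card \<tau> - 1\<close> points,
  and those of \<open>G\<close> are affinely independent.\<close>

lemma card_simplex_graph_le:
  fixes T :: "((real ^ 'r::finite) \<times> (real ^ 'e::finite)) set"
  assumes indep: "\<not> affine_dependent {v. v extreme_point_of T}"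
    and G: "G \<subseteq> simplex_graph T" "G \<subseteq> UNIV \<times> \<tau>" and \<tau>: "\<tau> \<noteq> {}"
  shows "card G < CARD('r) + card \<tau>"
proof -
  let ?pv = "\<lambda>(r :: 'r, e :: 'e). product_vertex r e"
  obtain e0 where e0: "e0 \<in> \<tau>" using \<tau> by blast
  obtain r0 :: 'r where True by blast
  \<comment> \<open>The spanning tree of all edges at \<open>e0\<close> or at
    \<open>r0\<close>.\<close>
  let ?B = "range (\<lambda>r. product_vertex r e0) \<union> (\<lambda>e. product_vertex r0 e) ` (\<tau> - {e0})"
  have "card ?B \<le> CARD('r) + card (\<tau> - {e0})"
    by (intro order_trans[OF card_Un_le] add_mono card_image_le) auto
  moreover have "card \<tau> = Suc (card (\<tau> - {e0}))" using e0 by (metis card.remove finite)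
  ultimately have B: "card ?B < CARD('r) + card \<tau>" by simp
  have "product_vertex r e \<in> affine hull ?B" if "(r, e) \<in> G" for r e
  proof -
    from that G have "e \<in> \<tau>" by auto
    have *: "product_vertex r0 e \<in> affine hull ?B" if "e \<in> \<tau>" for e
      using that by (cases "e = e0") (auto intro!: hull_inc)
    \<comment> \<open>The 4-cycle through \<open>r\<close>, \<open>e0\<close>, \<open>r0\<close>,
      \<open>e\<close> is an affine relation that expresses the edge \<open>(r, e)\<close> by three
      edges of the tree.\<close>
    have "product_vertex r e0 + 1 *\<^sub>R (product_vertex r0 e - product_vertex r0 e0) \<in> affine hull ?B"
      using * e0 \<open>e \<in> \<tau>\<close> by (intro mem_affine_3_minus) (auto intro!: hull_inc)
    also have "product_vertex r e0 + 1 *\<^sub>R (product_vertex r0 e - product_vertex r0 e0) = product_vertex r e"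
      by (simp add: product_vertex_def)
    finally show ?thesis .
  qed
  then have "?pv ` G \<subseteq> affine hull ?B" by auto
  then have "aff_dim (?pv ` G) \<le> aff_dim ?B"
    by (metis aff_dim_affine_hull aff_dim_subset)
  also have "\<dots> \<le> int (card ?B) - 1" by (intro aff_dim_le_card) simp
  finally have "aff_dim (?pv ` G) \<le> int (card ?B) - 1" .
  moreover have "\<not> affine_dependent (?pv ` G)"
    using G by (intro affine_independent_subset[OF indep]) (auto simp: simplex_graph_def)
  then have "aff_dim (?pv ` G) = int (card G) - 1"
    by (simp add: affine_independent_iff_card card_image[OF inj_product_vertex])
  ultimately show ?thesis using B by simp
qed

section \<open>The linkage tree\<close>

lemma card_subset_Suc_eq:
  assumes "card \<tau> = Suc d" "\<sigma> \<subseteq> \<tau>" "card \<sigma> = d"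
  obtains x where "x \<in> \<tau>" "\<sigma> = \<tau> - {x}"
proof -
  have fin: "finite \<tau>" using assms(1) card.infinite by fastforce
  have "card (\<tau> - \<sigma>) = 1" using assms fin by (simp add: card_Diff_subset finite_subset)
  then obtain x where "\<tau> - \<sigma> = {x}" by (auto simp: card_1_singleton_iff)
  then have "x \<in> \<tau>" "\<sigma> = \<tau> - {x}" using assms(2) by auto
  then show thesis by (rule that)
qed

lemma linkage_tree_eq:
  fixes M :: "'e set \<Rightarrow> ('r::finite \<times> 'e) set"
  assumes "card \<tau> = CARD('r) + 1"
  shows "linkage_tree M \<tau> = (\<Union>x\<in>\<tau>. M (\<tau> - {x}))"
proof -
  have fin: "finite \<tau>" using assms card.infinite by fastforce
  have "{\<sigma>. \<sigma> \<subseteq> \<tau> \<and> card \<sigma> = CARD('r)} = (\<lambda>x. \<tau> - {x}) ` \<tau>"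
  proof (intro subset_antisym subsetI)
    fix \<sigma> assume "\<sigma> \<in> {\<sigma>. \<sigma> \<subseteq> \<tau> \<and> card \<sigma> = CARD('r)}"
    then show "\<sigma> \<in> (\<lambda>x. \<tau> - {x}) ` \<tau>"
      using assms card_subset_Suc_eq[of \<tau> "CARD('r)" \<sigma>] by auto
  qed (use assms fin in auto)
  then show ?thesis unfolding linkage_tree_def by simp
qed

lemma polyhedral_matching:
  fixes M :: "'e::finite set \<Rightarrow> ('r::finite \<times> 'e) set"
  assumes "polyhedral_matching_field \<T> M" "card \<tau> = CARD('r) + 1" "x \<in> \<tau>"
  shows "perfect_matching (\<tau> - {x}) (M (\<tau> - {x}))"
  using assms unfolding polyhedral_matching_field_def by simp

text \<open>
  Every degree is at least 2 because each element of \<open>\<tau>\<close> is avoided by some matching, and affine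
  independence of the vertices of a simplex leaves room for only \<open>2 d\<close> edges.
\<close>
lemma linkage_tree_degree:
  fixes \<T> :: "((real ^ 'r::finite) \<times> (real ^ 'e::finite)) set set"
  assumes tri: "simplex_product_triangulation \<T>"
    and M: "polyhedral_matching_field \<T> M"
    and \<tau>: "card \<tau> = CARD('r) + 1"
  shows "card {e. (r, e) \<in> linkage_tree M \<tau>} = 2"
proof -
  let ?L = "linkage_tree M \<tau>"
  let ?D = "\<lambda>r. {e. (r, e) \<in> ?L}"
  note L = linkage_tree_eq[OF \<tau>, of M]
  note pm = polyhedral_matching[OF M \<tau>]
  have "\<tau> \<noteq> {}" using \<tau> by auto
  have ge: "2 \<le> card (?D r)" for r
  proof -
    have ex: "\<exists>e. e \<in> \<tau> \<and> e \<noteq> x \<and> e \<in> ?D r" if mem: "x \<in> \<tau>" for x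
    proof -
      obtain e where e: "(r, e) \<in> M (\<tau> - {x})"
        using pm[OF mem] unfolding perfect_matching_def by blast
      moreover have "M (\<tau> - {x}) \<subseteq> UNIV \<times> (\<tau> - {x})"
        using pm[OF mem] unfolding perfect_matching_def by blast
      ultimately show ?thesis using mem unfolding L by blast
    qed
    \<comment> \<open>Avoiding any \<open>x\<close> yields a first neighbour \<open>e\<close>;
      avoiding \<open>e\<close> yields a second one.\<close>
    obtain x where "x \<in> \<tau>" using \<open>\<tau> \<noteq> {}\<close> by blast
    with ex obtain e where "e \<in> \<tau>" "e \<in> ?D r" by blast
    moreover from this ex obtain e' where "e' \<in> ?D r" "e' \<noteq> e" by blast
    ultimately have "e \<in> ?D r" "e' \<in> ?D r" "e' \<noteq> e" by auto
    then have "card {e, e'} \<le> card (?D r)" by (intro card_mono) auto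
    with \<open>e' \<noteq> e\<close> show ?thesis by simp
  qed
  obtain T where T: "T \<in> \<T>" "?L \<subseteq> simplex_graph T"
    using linkage_tree_subset_simplex_graph[OF tri M \<tau>] by blast
  have "\<not> affine_dependent {v. v extreme_point_of T}"
    using tri T(1) triangulation_simplex_vertices unfolding simplex_product_triangulation_def by blast
  moreover have "?L \<subseteq> UNIV \<times> \<tau>"
    using pm unfolding L perfect_matching_def by blast
  ultimately have "card ?L < CARD('r) + card \<tau>"
    using T(2) \<open>\<tau> \<noteq> {}\<close> by (intro card_simplex_graph_le)
  moreover have "?L = Sigma UNIV ?D" by auto
  then have "card ?L = (\<Sum>r\<in>UNIV. card (?D r))"
    by (metis card_SigmaI finite)
  \<comment> \<open>The strict bound \<open>d + (d + 1)\<close> leaves at most \<open>2 d\<close>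
    edges.\<close>
  ultimately have le: "(\<Sum>r\<in>UNIV. card (?D r)) \<le> (\<Sum>r\<in>(UNIV :: 'r set). 2)" using \<tau> by simp
  show ?thesis
  proof (rule ccontr)
    assume "card (?D r) \<noteq> 2"
    with ge[of r] have "2 < card (?D r)" by simp
    then have "(\<Sum>r\<in>(UNIV :: 'r set). 2) < (\<Sum>r\<in>UNIV. card (?D r))"
      using ge by (intro sum_strict_mono_ex1) auto
    with le show False by simp
  qed
qed

lemma perfect_matching_exchange:
  assumes "perfect_matching (\<tau> - {u}) N" "u \<in> \<tau>" "(r, v) \<in> N"
  shows "perfect_matching (\<tau> - {v}) (insert (r, u) (N - {(r, v)}))"
proof -
  have N: "N \<subseteq> UNIV \<times> (\<tau> - {u})" "\<And>r. \<exists>!e. (r, e) \<in> N" "\<And>e. e \<in> \<tau> - {u} \<Longrightarrow> \<exists>!r. (r, e) \<in> N"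
    using assms(1) unfolding perfect_matching_def by blast+
  have v: "v \<in> \<tau>" "v \<noteq> u" using N(1) assms(3) by auto
  have 1: "insert (r, u) (N - {(r, v)}) \<subseteq> UNIV \<times> (\<tau> - {v})"
    using N(1) N(3)[of v] v assms(2,3) by blast
  have 2: "\<exists>!e. (s, e) \<in> insert (r, u) (N - {(r, v)})" for s
    using N(2)[of s] N(2)[of r] assms(3) by (cases "s = r") auto
  have 3: "\<exists>!s. (s, e) \<in> insert (r, u) (N - {(r, v)})" if "e \<in> \<tau> - {v}" for e
    using N(1) N(3)[of e] that by (cases "e = u") auto
  show ?thesis using 1 2 3 unfolding perfect_matching_def by simp
qed

text \<open>As \<open>u\<close> and \<open>v\<close> are the only neighbours of \<open>r\<close>,
  the matching avoiding \<open>u\<close> must send \<open>r\<close> to \<open>v\<close>. Redirecting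
  \<open>r\<close> to \<open>u\<close> gives a matching on \<open>\<tau> - {v}\<close> within the
  same cell, so uniqueness identifies it.\<close>

lemma linkage_tree_exchange:
  fixes \<T> :: "((real ^ 'r::finite) \<times> (real ^ 'e::finite)) set set"
  assumes tri: "simplex_product_triangulation \<T>"
    and M: "polyhedral_matching_field \<T> M"
    and \<tau>: "card \<tau> = CARD('r) + 1"
    and uv: "(r, u) \<in> linkage_tree M \<tau>" "(r, v) \<in> linkage_tree M \<tau>" "u \<noteq> v"
  shows "u \<in> \<tau>" "v \<in> \<tau>" "(r, v) \<in> M (\<tau> - {u})"
    "M (\<tau> - {v}) = insert (r, u) (M (\<tau> - {u}) - {(r, v)})"
proof -
  let ?L = "linkage_tree M \<tau>"
  note L = linkage_tree_eq[OF \<tau>, of M]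
  note pm = polyhedral_matching[OF M \<tau>]
  have "?L \<subseteq> UNIV \<times> \<tau>"
    using pm unfolding L perfect_matching_def by blast
  with uv show mem: "u \<in> \<tau>" "v \<in> \<tau>" by auto
  have D: "{u, v} = {e. (r, e) \<in> ?L}"
    using uv linkage_tree_degree[OF tri M \<tau>, of r] by (intro card_subset_eq) auto
  obtain x where x: "(r, x) \<in> M (\<tau> - {u})" "x \<noteq> u"
    using pm[OF mem(1)] unfolding perfect_matching_def by blast
  then have "x \<in> {e. (r, e) \<in> ?L}" using mem(1) unfolding L by blast
  with x D show rv: "(r, v) \<in> M (\<tau> - {u})" by auto
  obtain T where T: "T \<in> \<T>" "?L \<subseteq> simplex_graph T"
    using linkage_tree_subset_simplex_graph[OF tri M \<tau>] by blast
  have tri': "triangulation \<T>" using tri unfolding simplex_product_triangulation_def by blast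
  have sub: "M (\<tau> - {v}) \<subseteq> ?L" "M (\<tau> - {u}) \<subseteq> ?L" using mem unfolding L by blast+
  show "M (\<tau> - {v}) = insert (r, u) (M (\<tau> - {u}) - {(r, v)})"
    by (rule matching_in_triangulation_unique[OF tri' T(1) T(1) pm[OF mem(2)] _
          perfect_matching_exchange[OF pm[OF mem(1)] mem(1) rv]])
      (use sub T(2) uv in auto)
qed

text \<open>
  A union of components meeting \<open>\<tau>\<close> in \<open>S\<close> has as many R-nodes as \<open>S - {x}\<close> has elements, for
  every \<open>x \<in> \<tau>\<close>; this count depends on whether \<open>x \<in> S\<close> unless \<open>S\<close> is everything.
\<close>
lemma linkage_tree_connected:
  fixes \<T> :: "((real ^ 'r::finite) \<times> (real ^ 'e::finite)) set set"
  assumes M: "polyhedral_matching_field \<T> M"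
    and \<tau>: "card \<tau> = CARD('r) + 1"
    and S: "S \<subseteq> \<tau>" "S \<noteq> {}"
    and closed: "\<And>r u v. (r, u) \<in> linkage_tree M \<tau> \<Longrightarrow> (r, v) \<in> linkage_tree M \<tau> \<Longrightarrow> u \<in> S \<Longrightarrow> v \<in> S"
  shows "S = \<tau>"
proof (rule ccontr)
  assume "S \<noteq> \<tau>"
  with S obtain u v where uv: "u \<in> S" "v \<in> \<tau>" "v \<notin> S" by blast
  let ?R = "{r. \<exists>e\<in>S. (r, e) \<in> linkage_tree M \<tau>}"
  note L = linkage_tree_eq[OF \<tau>, of M]
  have eq: "card (S - {x}) = card ?R" if x: "x \<in> \<tau>" for x
  proof -
    note pm = polyhedral_matching[OF M \<tau> x]
    note bij = perfect_matching_bij[OF pm]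
    \<comment> \<open>The part of the matching ending in \<open>S\<close> pairs
      \<open>S - {x}\<close> with \<open>?R\<close>.\<close>
    let ?K = "{p \<in> M (\<tau> - {x}). snd p \<in> S}"
    have sub: "M (\<tau> - {x}) \<subseteq> linkage_tree M \<tau>" using x unfolding L by blast
    have "snd ` ?K = snd ` M (\<tau> - {x}) \<inter> S" by auto
    then have "snd ` ?K = S - {x}"
      unfolding bij_betw_imp_surj_on[OF bij(2)] using S(1) by blast
    moreover have "fst ` ?K = ?R"
    proof (intro subset_antisym subsetI)
      fix r assume "r \<in> ?R"
      moreover obtain e where e: "(r, e) \<in> M (\<tau> - {x})"
        using pm unfolding perfect_matching_def by blast
      \<comment> \<open>\<open>r\<close> has some neighbour in \<open>S\<close>, so closedness puts
        its partner \<open>e\<close> there too.\<close>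
      ultimately have "e \<in> S" using closed sub by blast
      with e show "r \<in> fst ` ?K" by force
    qed (use sub in force)
    moreover have "inj_on snd ?K" "inj_on fst ?K"
      using bij unfolding bij_betw_def by (auto intro: inj_on_subset)
    ultimately show ?thesis
      using card_image[of snd ?K] card_image[of fst ?K] by simp
  qed
  have "card (S - {u}) = card (S - {v})"
    by (rule trans[OF eq[OF subsetD[OF S(1) uv(1)]] eq[OF uv(2), symmetric]])
  moreover have "card (S - {u}) < card S" using uv(1) by (intro card_Diff1_less) auto
  ultimately show False using uv(3) by simp
qed

section \<open>Signed circuits\<close>

text \<open>The two sides are, up to the minus sign, the head expansions of
  \<open>e # f # xs\<close> and \<open>f # e # xs\<close>, which differ by one swap.\<close>

lemma sign_rank_perm_exchange:
  assumes "distinct (e # f # xs)"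
  shows "(-1) ^ card {y \<in> set (e # f # xs). y < e} * sign (rank_perm (f # xs)) =
    - ((-1) ^ card {y \<in> set (e # f # xs). y < f} * sign (rank_perm (e # xs)))"
proof -
  have sets: "{y \<in> set (e # f # xs). y < e} = {y \<in> set (f # xs). y < e}"
    "{y \<in> set (e # f # xs). y < f} = {y \<in> set (e # xs). y < f}" by auto
  have 1: "sign (rank_perm (e # f # xs)) =
      (-1) ^ card {y \<in> set (f # xs). y < e} * sign (rank_perm (f # xs))"
    by (rule sign_rank_perm_Cons[OF assms])
  have 2: "sign (rank_perm (f # e # xs)) =
      (-1) ^ card {y \<in> set (e # xs). y < f} * sign (rank_perm (e # xs))"
    using assms by (intro sign_rank_perm_Cons) auto
  show ?thesis
    unfolding sets 1[symmetric] 2[symmetric] using sign_rank_perm_swap[OF assms] by linarith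
qed

text \<open>The partner lists agree except at the position of \<open>r\<close>. Moving that entry to
  the front costs both lists the same sign, with \<open>k\<close> the number of elements of R before
  \<open>r\<close>.\<close>

lemma matching_sign_exchange:
  fixes N :: "('r::{finite,linorder} \<times> 'e::linorder) set"
  assumes N: "perfect_matching \<sigma> N" "(r, v) \<in> N"
    and N': "perfect_matching \<sigma>' N'" "N' = insert (r, u) (N - {(r, v)})"
  obtains k xs where "distinct (v # xs)" "set (v # xs) = \<sigma>"
    "matching_sign N = (-1) ^ k * sign (rank_perm (v # xs))"
    "matching_sign N' = (-1) ^ k * sign (rank_perm (u # xs))"
    "distinct (u # xs)"
proof -
  define g where "g N s = (THE e. (s, e) \<in> N)" for N :: "('r \<times> 'e) set" and s
  have g: "g N s = e" if "perfect_matching \<sigma> N" "(s, e) \<in> N" for N \<sigma> s e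
  proof -
    have "\<exists>!e. (s, e) \<in> N" using that(1) unfolding perfect_matching_def by simp
    with that(2) show ?thesis unfolding g_def by (intro the1_equality)
  qed
  have g_mem: "(s, g N s) \<in> N" if "perfect_matching \<sigma> N" for N \<sigma> s
  proof -
    have "\<exists>e. (s, e) \<in> N" using that unfolding perfect_matching_def by blast
    with g[OF that, of s] show ?thesis by auto
  qed
  have inj: "inj (g N)" and range: "range (g N) = \<sigma>" if "perfect_matching \<sigma> N" for N \<sigma>
  proof -
    show "inj (g N)"
    proof (rule injI)
      fix s s' assume "g N s = g N s'"
      then have N: "(s, g N s) \<in> N" "(s', g N s) \<in> N"
        using g_mem[OF that, of s] g_mem[OF that, of s'] by simp_all
      with that have "\<exists>!r. (r, g N s) \<in> N" unfolding perfect_matching_def by blast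
      with N show "s = s'" by blast
    qed
    show "range (g N) = \<sigma>"
    proof (intro subset_antisym subsetI)
      fix e assume "e \<in> \<sigma>"
      then have "\<exists>s. (s, e) \<in> N" using that unfolding perfect_matching_def by blast
      then show "e \<in> range (g N)" using g[OF that] by blast
    next
      fix e assume "e \<in> range (g N)"
      then show "e \<in> \<sigma>" using g_mem[OF that] that unfolding perfect_matching_def by blast
    qed
  qed
  have "r \<in> set (sorted_list_of_set UNIV)" by simp
  then obtain as bs where split: "sorted_list_of_set UNIV = as @ r # bs"
    by (meson split_list)
  have dist: "distinct (as @ r # bs)" and set: "set (as @ r # bs) = UNIV"
    unfolding split[symmetric] by simp_all
  have same: "g N' s = g N s" if "s \<noteq> r" for s
    using g_mem[OF N(1), of s] that unfolding N'(2) by (intro g[OF N'(1)[unfolded N'(2)]]) auto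
  have gr: "g N r = v" "g N' r = u" using g[OF N] g[OF N'(1)] N'(2) by auto
  let ?as = "map (g N) as" and ?bs = "map (g N) bs"
  have map: "map (g N) (sorted_list_of_set UNIV) = ?as @ v # ?bs"
    "map (g N') (sorted_list_of_set UNIV) = ?as @ u # ?bs"
    unfolding split using dist gr by (auto intro!: same)
  have "distinct (map (g N) (sorted_list_of_set UNIV))" "distinct (map (g N') (sorted_list_of_set UNIV))"
    using inj[OF N(1)] inj[OF N'(1)] by (auto simp: distinct_map intro: inj_on_subset)
  note d = this[unfolded map]
  have "set (map (g N) (sorted_list_of_set UNIV)) = \<sigma>"
    using range[OF N(1)] by simp
  then have "set (v # ?as @ ?bs) = \<sigma>" unfolding map by auto
  moreover have "distinct (v # ?as @ ?bs)" "distinct (u # ?as @ ?bs)" using d by auto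
  moreover have "matching_sign N = (-1) ^ length ?as * sign (rank_perm (v # ?as @ ?bs))"
    "matching_sign N' = (-1) ^ length ?as * sign (rank_perm (u # ?as @ ?bs))"
    unfolding matching_sign_def g_def[symmetric] map
    using d by (simp_all only: sign_rank_perm_append_Cons)
  ultimately show thesis by (intro that)
qed

text \<open>The vector \<open>\<Phi>\<close> of the overview. It imitates Cramer's rule: alternating
  maximal minors are the coefficients of the linear relation among \<open>d + 1\<close> vectors in
  rank \<open>d\<close>.\<close>

definition circuit_sign ::
    "('r::{finite,linorder} \<Rightarrow> 'e::linorder \<Rightarrow> int) \<Rightarrow> ('e set \<Rightarrow> ('r \<times> 'e) set) \<Rightarrow> 'e set \<Rightarrow> 'e \<Rightarrow> int" where
  "circuit_sign A M \<tau> u =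
     (if u \<in> \<tau> then (-1) ^ card {y \<in> \<tau>. y < u} * chi_set A M (\<tau> - {u}) else 0)"

text \<open>Both values carry the same unit factor, which cancels in the pivoting rule and leaves
  \<open>\<Phi> e = C e * C f * \<Phi> f\<close>.\<close>

lemma chi_eq_circuit_sign:
  fixes M :: "'e set \<Rightarrow> ('r::{finite,linorder} \<times> 'e::linorder) set"
  assumes "distinct (e # f # xs)" "Suc (length xs) = CARD('r)" "set (e # f # xs) = \<tau>"
  shows "chi A M (e # xs) = (-1) ^ card {y \<in> \<tau>. y < f} * sign (rank_perm (e # xs)) * circuit_sign A M \<tau> f"
    and "chi A M (f # xs) = - ((-1) ^ card {y \<in> \<tau>. y < f} * sign (rank_perm (e # xs)) * circuit_sign A M \<tau> e)"
proof -
  have "set (e # xs) = \<tau> - {f}" "set (f # xs) = \<tau> - {e}" "e \<in> \<tau>" "f \<in> \<tau>"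
    "distinct (e # xs)" "distinct (f # xs)" using assms by auto
  then have 1: "chi A M (e # xs) = sign (rank_perm (e # xs)) * chi_set A M (\<tau> - {f})"
    "chi A M (f # xs) = sign (rank_perm (f # xs)) * chi_set A M (\<tau> - {e})"
    "circuit_sign A M \<tau> f = (-1) ^ card {y \<in> \<tau>. y < f} * chi_set A M (\<tau> - {f})"
    "circuit_sign A M \<tau> e = (-1) ^ card {y \<in> \<tau>. y < e} * chi_set A M (\<tau> - {e})"
    using assms(2) \<open>distinct (e # xs)\<close> \<open>distinct (f # xs)\<close> unfolding chi_def circuit_sign_def by simp_all
  have sq: "(-1) ^ k * ((-1) ^ k * x) = x" for k and x :: int
    by (simp flip: mult.assoc power_add)
  show "chi A M (e # xs) = (-1) ^ card {y \<in> \<tau>. y < f} * sign (rank_perm (e # xs)) * circuit_sign A M \<tau> f"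
    unfolding 1 by (simp add: mult.left_commute sq)
  have "(-1) ^ card {y \<in> \<tau>. y < e} * sign (rank_perm (f # xs)) =
    - ((-1) ^ card {y \<in> \<tau>. y < f} * sign (rank_perm (e # xs)))"
    using sign_rank_perm_exchange[OF assms(1)] unfolding assms(3) .
  then have "- ((-1) ^ card {y \<in> \<tau>. y < f} * sign (rank_perm (e # xs)) * circuit_sign A M \<tau> e) = 
    (-1) ^ card {y \<in> \<tau>. y < e} * sign (rank_perm (f # xs)) * circuit_sign A M \<tau> e" by simp
  also have "\<dots> = sign (rank_perm (f # xs)) * chi_set A M (\<tau> - {e})"
    unfolding 1 by (simp add: mult.left_commute sq)
  finally show "chi A M (f # xs) = - ((-1) ^ card {y \<in> \<tau>. y < f} * sign (rank_perm (e # xs)) * circuit_sign A M \<tau> e)"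
    unfolding 1(2) ..
qed

text \<open>The entries of \<open>A\<close> on the shared edges \<open>K\<close> and the sign
  \<open>(-1) ^ k\<close> occur in both factors and square to 1. Only the two entries at
  \<open>r\<close> survive, and the minus sign is that of
  \<open>sign_rank_perm_exchange\<close>.\<close>

lemma circuit_sign_exchange:
  fixes \<T> :: "((real ^ 'r::{finite,linorder}) \<times> (real ^ 'e::{finite,linorder})) set set"
  assumes tri: "simplex_product_triangulation \<T>"
    and M: "polyhedral_matching_field \<T> M"
    and A: "\<And>\<sigma> r e. card \<sigma> = CARD('r) \<Longrightarrow> (r, e) \<in> M \<sigma> \<Longrightarrow> A r e \<in> {-1, 1}"
    and \<tau>: "card \<tau> = CARD('r) + 1"
    and uv: "(r, u) \<in> linkage_tree M \<tau>" "(r, v) \<in> linkage_tree M \<tau>" "u \<noteq> v"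
  shows "circuit_sign A M \<tau> u * circuit_sign A M \<tau> v = - A r u * A r v"
proof -
  note ex = linkage_tree_exchange[OF tri M \<tau> uv]
  note pm = polyhedral_matching[OF M \<tau>]
  define K where "K = M (\<tau> - {u}) - {(r, v)}"
  define P where "P = (\<Prod>(s, e)\<in>K. A s e)"
  have Mu: "M (\<tau> - {u}) = insert (r, v) K" and Mv: "M (\<tau> - {v}) = insert (r, u) K"
    using ex(3,4) unfolding K_def by (simp_all add: insert_absorb)
  have "(r, u) \<notin> K" "(r, v) \<notin> K" 
    using pm[OF ex(1)] unfolding K_def perfect_matching_def by auto
  then have prod: "(\<Prod>(s, e)\<in>M (\<tau> - {u}). A s e) = A r v * P" "(\<Prod>(s, e)\<in>M (\<tau> - {v}). A s e) = A r u * P"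
    unfolding Mu Mv P_def by simp_all
  have "A s e \<in> {-1, 1}" if "(s, e) \<in> K" for s e
    using that ex(1) \<tau> by (intro A[of "\<tau> - {u}"]) (auto simp: K_def)
  then have "A s e * A s e = 1" if "(s, e) \<in> K" for s e
    using that by fastforce
  then have PP: "P * P = 1"
    unfolding P_def by (subst prod.distrib[symmetric]) (auto intro!: prod.neutral)
  obtain k xs where xs: "distinct (v # xs)" "set (v # xs) = \<tau> - {u}" "distinct (u # xs)"
    and sgn: "matching_sign (M (\<tau> - {u})) = (-1) ^ k * sign (rank_perm (v # xs))"
    "matching_sign (M (\<tau> - {v})) = (-1) ^ k * sign (rank_perm (u # xs))"
    using matching_sign_exchange[OF pm[OF ex(1)] ex(3) pm[OF ex(2)] ex(4)] by metis
  have uvxs: "distinct (u # v # xs)" "set (u # v # xs) = \<tau>" using xs uv ex by auto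
  define c d where "c = (-1 :: int) ^ card {y \<in> \<tau>. y < u} * sign (rank_perm (v # xs))"
    and "d = (-1 :: int) ^ card {y \<in> \<tau>. y < v} * sign (rank_perm (u # xs))"
  have cd: "c = - d"
    using sign_rank_perm_exchange[OF uvxs(1)] unfolding uvxs(2) c_def d_def .
  have dd: "d * d = 1"
    unfolding d_def by (simp add: minus_one_power_iff)
  have kk: "(-1) ^ k * (-1 :: int) ^ k = 1" by (simp add: minus_one_power_iff)
  have "circuit_sign A M \<tau> u = c * (-1) ^ k * A r v * P" "circuit_sign A M \<tau> v = d * (-1) ^ k * A r u * P"
    using ex(1,2) unfolding circuit_sign_def chi_set_def sgn prod c_def d_def by simp_all
  then have "circuit_sign A M \<tau> u * circuit_sign A M \<tau> v = - (d * d) * ((-1) ^ k * (-1) ^ k) * (P * P) * A r u * A r v"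
    unfolding cd by (simp add: algebra_simps)
  then show ?thesis unfolding dd kk PP by simp
qed

section \<open>Signed circuits supported on a (d+1)-subset\<close>

lemma chi_set_sign:
  fixes M :: "'e::{finite,linorder} set \<Rightarrow> ('r::{finite,linorder} \<times> 'e) set"
  assumes "\<And>r e. (r, e) \<in> M \<sigma> \<Longrightarrow> A r e \<in> {-1, 1}"
  shows "chi_set A M \<sigma> \<in> {-1, 1}"
proof -
  have "\<bar>\<Prod>(r, e)\<in>M \<sigma>. A r e\<bar> = (\<Prod>x\<in>M \<sigma>. 1)"
    unfolding abs_prod using assms by (intro prod.cong) fastforce+
  then have "\<bar>chi_set A M \<sigma>\<bar> = 1"
    unfolding chi_set_def abs_mult matching_sign_def by simp
  then show ?thesis by auto
qed

lemma circuit_sign_assignment: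
  fixes M :: "'e::{finite,linorder} set \<Rightarrow> ('r::{finite,linorder} \<times> 'e) set"
  assumes \<tau>: "card \<tau> = CARD('r) + 1"
    and chi: "\<And>\<sigma>. card \<sigma> = CARD('r) \<Longrightarrow> chi_set A M \<sigma> \<in> {-1, 1}"
  shows "circuit_sign A M \<tau> \<in> sign_assignments \<tau>"
proof -
  have "circuit_sign A M \<tau> e \<in> {-1, 1}" if "e \<in> \<tau>" for e
  proof -
    have "\<bar>circuit_sign A M \<tau> e\<bar> = 1"
      using that \<tau> chi[of "\<tau> - {e}"] by (auto simp: circuit_sign_def abs_mult)
    then show ?thesis by auto
  qed
  then show ?thesis unfolding sign_assignments_def by (simp add: circuit_sign_def)
qed

text \<open>The constant product is 1 or -1, which decides between the two cases. Signed circuits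
  and compatible assignments are both compared with \<open>\<Phi>\<close> in this way.\<close>

lemma sign_assignments_eq_or_neg:
  assumes C: "C \<in> sign_assignments \<tau>" and D: "D \<in> sign_assignments \<tau>" and e: "e \<in> \<tau>"
    and const: "\<And>f. f \<in> \<tau> \<Longrightarrow> C f * D f = C e * D e"
  shows "C = D \<or> C = (\<lambda>f. - D f)"
proof -
  have 1: "C f \<in> {-1, 1}" "D f \<in> {-1, 1}" if "f \<in> \<tau>" for f
    using C D that unfolding sign_assignments_def by blast+
  have 0: "C f = 0" "D f = 0" if "f \<notin> \<tau>" for f
    using C D that unfolding sign_assignments_def by blast+
  show ?thesis
  proof (cases "C e = D e")
    case True
    have "C f = D f" for f
      using const[of f] True 0[of f] 1[of f] 1[OF e] by (cases "f \<in> \<tau>") auto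
    then show ?thesis by auto
  next
    case False
    have "C f = - D f" for f
      using const[of f] False 0[of f] 1[of f] 1[OF e] by (cases "f \<in> \<tau>") auto
    then show ?thesis by auto
  qed
qed

text \<open>The matroid is uniform: every d-subset is a basis because \<open>chi_set\<close> does
  not vanish there, and no basis is larger.\<close>

lemma is_circuit_chi:
  fixes M :: "'e::{finite,linorder} set \<Rightarrow> ('r::{finite,linorder} \<times> 'e) set"
  assumes \<tau>: "card \<tau> = CARD('r) + 1"
    and chi: "\<And>\<sigma>. card \<sigma> = CARD('r) \<Longrightarrow> chi_set A M \<sigma> \<noteq> 0"
  shows "is_circuit CARD('r) (chi A M) \<tau>"
  unfolding is_circuit_def
proof (intro conjI allI impI)
  have "card B = CARD('r)" if "is_basis CARD('r) (chi A M) B" for B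
    using that unfolding is_basis_def chi_def by (auto simp: distinct_card split: if_splits)
  then show "\<not> is_independent CARD('r) (chi A M) \<tau>"
    using \<tau> unfolding is_independent_def by (metis card_mono finite not_less_eq_eq Suc_eq_plus1 order_refl)
next
  fix I assume "I \<subset> \<tau>"
  then obtain x where x: "x \<in> \<tau>" "I \<subseteq> \<tau> - {x}" by blast
  with \<tau> have card: "card (\<tau> - {x}) = CARD('r)" by simp
  let ?xs = "sorted_list_of_set (\<tau> - {x})"
  have "is_basis CARD('r) (chi A M) (\<tau> - {x})"
    unfolding is_basis_def using card chi[OF card]
    by (intro exI[of _ ?xs]) (simp add: chi_def)
  with x(2) show "is_independent CARD('r) (chi A M) I" unfolding is_independent_def by blast
qed

lemma signed_circuits_on_support:
  fixes M :: "'e::{finite,linorder} set \<Rightarrow> ('r::{finite,linorder} \<times> 'e) set"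
  assumes \<tau>: "card \<tau> = CARD('r) + 1"
    and chi: "\<And>\<sigma>. card \<sigma> = CARD('r) \<Longrightarrow> chi_set A M \<sigma> \<in> {-1, 1}"
  shows "{C \<in> signed_circuits CARD('r) (chi A M). signed_support C = \<tau>} =
    {circuit_sign A M \<tau>, \<lambda>e. - circuit_sign A M \<tau> e}"
proof -
  let ?\<Phi> = "circuit_sign A M \<tau>"
  have \<Phi>s: "?\<Phi> \<in> sign_assignments \<tau>" using \<tau> chi by (rule circuit_sign_assignment)
  then have \<Phi>: "?\<Phi> e \<in> {-1, 1}" if "e \<in> \<tau>" for e
    using that unfolding sign_assignments_def by blast
  have \<Phi>0: "?\<Phi> e = 0" if "e \<notin> \<tau>" for e
    using that by (simp add: circuit_sign_def)
  have "\<tau> \<noteq> {}" using \<tau> by auto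
  then obtain e0 where e0: "e0 \<in> \<tau>" by blast
  have pivot: "chi A M (f # xs) = - C e * C f * chi A M (e # xs) \<longleftrightarrow> ?\<Phi> e = C e * C f * ?\<Phi> f"
    if "distinct (e # f # xs)" "Suc (length xs) = CARD('r)" "set (e # f # xs) = \<tau>" for e f xs C
    unfolding chi_eq_circuit_sign[OF that] by (simp add: mult.assoc)
  have mem: "C \<in> signed_circuits CARD('r) (chi A M) \<and> signed_support C = \<tau>"
    if C: "C = ?\<Phi> \<or> C = (\<lambda>e. - ?\<Phi> e)" for C
  proof -
    have supp: "signed_support C = \<tau>"
      using C \<Phi> \<Phi>0 unfolding signed_support_def by fastforce
    have "C e \<in> {-1, 0, 1}" for e
      using C \<Phi>[of e] \<Phi>0[of e] by (cases "e \<in> \<tau>") auto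
    then have "range C \<subseteq> {-1, 0, 1}" by blast
    moreover have "is_circuit CARD('r) (chi A M) \<tau>"
      using chi by (intro is_circuit_chi[OF \<tau>]) fastforce
    moreover have "chi A M (f # xs) = - C e * C f * chi A M (e # xs)"
      if ef: "e \<noteq> f" "Suc (length xs) = CARD('r)" "chi A M (e # xs) \<noteq> 0" "chi A M (f # xs) \<noteq> 0"
        "\<tau> \<subseteq> {e, f} \<union> set xs" for e f xs
    proof -
      \<comment> \<open>Non-zero values of \<open>chi\<close> exclude repetitions, so the
        \<open>d + 1\<close> entries exhaust \<open>\<tau>\<close>.\<close>
      have dist: "distinct (e # f # xs)" using ef(1,3,4) by (auto simp: chi_def split: if_splits)
      then have "card (set (e # f # xs)) = card \<tau>"
        using ef(2) \<tau> by (subst distinct_card) auto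
      then have set: "set (e # f # xs) = \<tau>"
        using ef(5) by (intro card_subset_eq[symmetric]) auto
      then have "e \<in> \<tau>" "f \<in> \<tau>" by auto
      with C \<Phi>[of e] \<Phi>[of f] show ?thesis
        unfolding pivot[OF dist ef(2) set] by auto
    qed
    ultimately show ?thesis using supp unfolding signed_circuits_def by blast
  qed
  have conv: "C = ?\<Phi> \<or> C = (\<lambda>e. - ?\<Phi> e)"
    if C: "C \<in> signed_circuits CARD('r) (chi A M)" "signed_support C = \<tau>" for C
  proof -
    have C1: "C e \<in> {-1, 1}" if "e \<in> \<tau>" for e
      using C that unfolding signed_circuits_def signed_support_def by blast
    have C0: "C e = 0" if "e \<notin> \<tau>" for e
      using C(2) that unfolding signed_support_def by blast
    have rel: "?\<Phi> e0 = C e0 * C f * ?\<Phi> f" if f: "f \<in> \<tau>" for f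
    proof (cases "f = e0")
      case True
      then show ?thesis using C1[OF e0] by auto
    next
      case False
      \<comment> \<open>The pivoting rule is only needed for pairs containing \<open>e0\<close>,
        with the other \<open>d - 1\<close> elements of \<open>\<tau>\<close> in any order.\<close>
      define xs where "xs = sorted_list_of_set (\<tau> - {e0, f})"
      have "card (\<tau> - {e0, f}) + 2 = card \<tau>"
        using e0 f False \<tau> by (subst card_Diff_subset) auto
      then have xs: "distinct (e0 # f # xs)" "Suc (length xs) = CARD('r)" "set (e0 # f # xs) = \<tau>"
        using e0 f False \<tau> unfolding xs_def by auto
      have nz: "chi A M (e0 # xs) \<noteq> 0" "chi A M (f # xs) \<noteq> 0"
        unfolding chi_eq_circuit_sign[OF xs] using \<Phi>[OF e0] \<Phi>[OF f] by auto
      have "chi A M (f # xs) = - C e0 * C f * chi A M (e0 # xs)"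
        using C xs nz False unfolding signed_circuits_def by auto
      then show ?thesis unfolding pivot[OF xs] .
    qed
    have "C \<in> sign_assignments \<tau>" using C1 C0 unfolding sign_assignments_def by blast
    then show ?thesis
    proof (rule sign_assignments_eq_or_neg[OF _ \<Phi>s e0])
      fix f assume "f \<in> \<tau>"
      then show "C f * ?\<Phi> f = C e0 * ?\<Phi> e0"
        unfolding rel[OF \<open>f \<in> \<tau>\<close>] using C1[OF e0] by auto
    qed
  qed
  show ?thesis using mem conv by blast
qed

section \<open>Compatible assignments of the signed tree\<close>

theorem proposition3p18:
  fixes \<T> :: "((real ^ 'r::{finite,linorder}) \<times> (real ^ 'e::{finite,linorder})) set set"
    and M :: "'e set \<Rightarrow> ('r \<times> 'e) set"
    and A :: "'r \<Rightarrow> 'e \<Rightarrow> int"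
    and \<tau> :: "'e set"
  assumes "CARD('r) \<le> CARD('e)"
    and "simplex_product_triangulation \<T>"
    and "polyhedral_matching_field \<T> M"
    and "\<And>r e. A r e \<in> {-1, 0, 1}"
    and "\<And>\<sigma> r e. card \<sigma> = CARD('r) \<Longrightarrow> (r, e) \<in> M \<sigma> \<Longrightarrow> A r e \<noteq> 0"
    and "card \<tau> = CARD('r) + 1"
  shows "card (compatible_assignments (signed_tree A M \<tau>) \<tau>) = 2 \<and>
         compatible_assignments (signed_tree A M \<tau>) \<tau> =
           {C \<in> signed_circuits CARD('r) (chi A M). signed_support C = \<tau>}"
proof -
  let ?\<Phi> = "circuit_sign A M \<tau>" and ?L = "linkage_tree M \<tau>"
  note tri = assms(2) and M = assms(3) and \<tau> = assms(6)
  have A: "A r e \<in> {-1, 1}" if "card \<sigma> = CARD('r)" "(r, e) \<in> M \<sigma>" for \<sigma> r e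
    using assms(4)[of r e] assms(5)[OF that] by auto
  have chi: "chi_set A M \<sigma> \<in> {-1, 1}" if "card \<sigma> = CARD('r)" for \<sigma>
    using A[OF that] by (rule chi_set_sign)
  have \<Phi>s: "?\<Phi> \<in> sign_assignments \<tau>" using \<tau> chi by (rule circuit_sign_assignment)
  then have \<Phi>: "?\<Phi> e \<in> {-1, 1}" if "e \<in> \<tau>" for e
    using that unfolding sign_assignments_def by blast
  have \<Phi>0: "?\<Phi> e = 0" if "e \<notin> \<tau>" for e
    using that by (simp add: circuit_sign_def)
  have "\<tau> \<noteq> {}" using \<tau> by auto
  then obtain e0 where e0: "e0 \<in> \<tau>" by blast
  have edge: "?\<Phi> u = ?\<Phi> v \<longleftrightarrow> - A r u * A r v = 1" "u \<in> \<tau>" "v \<in> \<tau>"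
    if "(r, u) \<in> ?L" "(r, v) \<in> ?L" "u \<noteq> v" for r u v
  proof -
    show uv: "u \<in> \<tau>" "v \<in> \<tau>"
      using linkage_tree_exchange(1,2)[OF tri M \<tau> that] by auto
    have "- A r u * A r v = ?\<Phi> u * ?\<Phi> v"
      using circuit_sign_exchange[of \<T> M A \<tau>, OF tri M A \<tau> that] by simp
    then show "?\<Phi> u = ?\<Phi> v \<longleftrightarrow> - A r u * A r v = 1"
      using \<Phi>[OF uv(1)] \<Phi>[OF uv(2)] by auto
  qed
  have pm: "C \<in> compatible_assignments (signed_tree A M \<tau>) \<tau>"
    if C: "C = ?\<Phi> \<or> C = (\<lambda>e. - ?\<Phi> e)" for C
  proof -
    have "C \<in> sign_assignments \<tau>"
      using C \<Phi> \<Phi>0 unfolding sign_assignments_def by fastforce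
    moreover have "C u = C v \<longleftrightarrow> s = 1" if mem: "({u, v}, s) \<in> signed_tree A M \<tau>" for u v s
    proof -
      \<comment> \<open>The unordered edge may list its ends the other way round; the condition is
        symmetric in them and unchanged by negating \<open>C\<close>.\<close>
      obtain r u' v' where *: "{u, v} = {u', v'}" "s = - A r u' * A r v'"
        "u' \<noteq> v'" "(r, u') \<in> ?L" "(r, v') \<in> ?L"
        using mem unfolding signed_tree_def by blast
      have "C u' = C v' \<longleftrightarrow> s = 1" using edge(1)[OF *(4,5,3)] C *(2) by auto
      with *(1) show ?thesis by (auto simp: doubleton_eq_iff)
    qed
    ultimately show ?thesis unfolding compatible_assignments_def by blast
  qed
  have conv: "C = ?\<Phi> \<or> C = (\<lambda>e. - ?\<Phi> e)"
    if C: "C \<in> compatible_assignments (signed_tree A M \<tau>) \<tau>" for C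
  proof -
    have C1: "C e \<in> {-1, 1}" if "e \<in> \<tau>" for e
      using C that unfolding compatible_assignments_def sign_assignments_def by blast
    \<comment> \<open>The nodes where \<open>C\<close> relates to \<open>\<Phi>\<close> as at
      \<open>e0\<close>; this set is closed under adjacency, hence is all of
      \<open>\<tau>\<close>.\<close>
    let ?S = "{e \<in> \<tau>. C e * ?\<Phi> e = C e0 * ?\<Phi> e0}"
    have "?S = \<tau>"
    proof (rule linkage_tree_connected[OF M \<tau>])
      fix r u v assume uv: "(r, u) \<in> ?L" "(r, v) \<in> ?L" "u \<in> ?S"
      show "v \<in> ?S"
      proof (cases "u = v")
        case False
        have "({u, v}, - A r u * A r v) \<in> signed_tree A M \<tau>"
          using uv False unfolding signed_tree_def by blast
        then have "C u = C v \<longleftrightarrow> - A r u * A r v = 1"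
          using C unfolding compatible_assignments_def by blast
        with edge[OF uv(1,2) False] have "C u = C v \<longleftrightarrow> ?\<Phi> u = ?\<Phi> v" "u \<in> \<tau>" "v \<in> \<tau>" by auto
        \<comment> \<open>Across the edge, \<open>C\<close> and \<open>\<Phi>\<close> either both
          keep or both change their sign.\<close>
        then have "C v * ?\<Phi> v = C u * ?\<Phi> u"
          using \<Phi>[of u] \<Phi>[of v] C1[of u] C1[of v] by auto
        with uv(3) \<open>v \<in> \<tau>\<close> show ?thesis by simp
      qed (use uv in simp)
    qed (use e0 in auto)
    then have rel: "C e * ?\<Phi> e = C e0 * ?\<Phi> e0" if "e \<in> \<tau>" for e using that by blast
    have "C \<in> sign_assignments \<tau>" using C unfolding compatible_assignments_def by blast
    then show ?thesis using rel by (rule sign_assignments_eq_or_neg[OF _ \<Phi>s e0])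
  qed
  have comp: "compatible_assignments (signed_tree A M \<tau>) \<tau> = {?\<Phi>, \<lambda>e. - ?\<Phi> e}"
    using pm conv by blast
  \<comment> \<open>A non-zero value separates the two assignments, so there are exactly
    two.\<close>
  have "?\<Phi> e0 \<noteq> - ?\<Phi> e0" using \<Phi>[OF e0] by auto
  then have "?\<Phi> \<noteq> (\<lambda>e. - ?\<Phi> e)" by metis
  then show ?thesis
    using signed_circuits_on_support[OF \<tau> chi] by (simp add: comp)
qed

end
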